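(* Let $n\ge1$ and $X=\mathbb{R}^n$. The $\sigma$-ideal $\sigma\mathcal{C}_0$ generated by tame Cantor sets in $X$ is contained in every non-trivial topologically invariant $\sigma$-ideal $\mathcal I$ on $X$ with analytic base.
   Context: An ideal on a set $X$ is a non-empty family of subsets closed under subsets and finite unions; a $\sigma$-ideal is closed under countable unions. An ideal $\mathcal I$ on $X$ is non-trivial if it contains an uncountable set and $\mathcal I\neq\mathcal P(X)$. A $\sigma$-ideal $\mathcal I$ on $X$ is topologically invariant if $\mathcal I=\{h(A):A\in\mathcal I\}$ for every homeomorphism $h:X\to X$. $\mathcal I$ has analytic base if every member of $\mathcal I$ is contained in an analytic set belonging to $\mathcal I$ (analytic = continuous image of a Polish space). A Cantor set is a subset homeomorphic to $\{0,1\}^\omega$. A subset $C\subseteq\mathbb{R}^n$ is a tame Cantor set if there is a homeomorphism $h:\mathbb{R}^n\to\mathbb{R}^n$ with $h(C)$ a Cantor set contained in the line $\mathbb{R}\times\{0\}^{n-1}$. $\sigma\mathcal C_0$ consists of all subsets of countable unions of tame Cantor sets in $\mathbb{R}^n$. *)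

theory Defs
  imports "HOL-Analysis.Analysis"
begin

definition set_ideal :: "'a set \<Rightarrow> 'a set set \<Rightarrow> bool" where
  "set_ideal X \<I> \<longleftrightarrow>
     \<I> \<subseteq> Pow X \<and> \<I> \<noteq> {} \<and>
     (\<forall>A\<in>\<I>. \<forall>B. B \<subseteq> A \<longrightarrow> B \<in> \<I>) \<and>
     (\<forall>\<A>. finite \<A> \<and> \<A> \<subseteq> \<I> \<longrightarrow> \<Union>\<A> \<in> \<I>)"

definition sigma_ideal :: "'a set \<Rightarrow> 'a set set \<Rightarrow> bool" where
  "sigma_ideal X \<I> \<longleftrightarrow>
     set_ideal X \<I> \<and> (\<forall>\<A>. countable \<A> \<and> \<A> \<subseteq> \<I> \<longrightarrow> \<Union>\<A> \<in> \<I>)"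

definition nontrivial_ideal :: "'a set \<Rightarrow> 'a set set \<Rightarrow> bool" where
  "nontrivial_ideal X \<I> \<longleftrightarrow> (\<exists>A\<in>\<I>. uncountable A) \<and> \<I> \<noteq> Pow X"

definition topologically_invariant :: "'a::topological_space set \<Rightarrow> 'a set set \<Rightarrow> bool" where
  "topologically_invariant X \<I> \<longleftrightarrow>
     (\<forall>h g. homeomorphism X X h g \<longrightarrow> \<I> = {h ` A | A. A \<in> \<I>})"

definition Polish_space :: "'a topology \<Rightarrow> bool" where
  "Polish_space T \<longleftrightarrow> completely_metrizable_space T \<and> separable_space T"

text \<open>
  HOL cannot quantify over types inside a definition, so the Polish space is an arbitrary Polish
  topology carried by a subset of \<open>nat \<Rightarrow> real\<close> (unrelated to the product topology there).
  No Polish space is lost: see \<open>analytic_setI\<close> below. The empty space is Polish, so the empty set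
  is analytic.
\<close>
definition analytic_set :: "'a::topological_space set \<Rightarrow> bool" where
  "analytic_set A \<longleftrightarrow>
     (\<exists>(T :: (nat \<Rightarrow> real) topology) f.
        Polish_space T \<and> continuous_map T euclidean f \<and> A = f ` topspace T)"

definition has_analytic_base :: "'a::topological_space set set \<Rightarrow> bool" where
  "has_analytic_base \<I> \<longleftrightarrow> (\<forall>A\<in>\<I>. \<exists>B\<in>\<I>. A \<subseteq> B \<and> analytic_set B)"

definition Cantor_set :: "'a::topological_space set \<Rightarrow> bool" where
  "Cantor_set C \<longleftrightarrow> C homeomorphic (UNIV :: (nat \<Rightarrow> bool) set)"

text \<open>
  The index type of \<open>real ^ 'n\<close> carries no order, so the coordinate that plays the role of the first
  one is a parameter: \<open>coordinate_line k\<close> is the line \<open>\<real> \<times> {0}\<^sup>n\<^sup>-\<^sup>1\<close> when \<open>k\<close> is that coordinate.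
\<close>
definition coordinate_line :: "'n::finite \<Rightarrow> (real ^ 'n) set" where
  "coordinate_line k = {x. \<forall>i. i \<noteq> k \<longrightarrow> x $ i = 0}"

definition tame_Cantor_set :: "'n::finite \<Rightarrow> (real ^ 'n) set \<Rightarrow> bool" where
  "tame_Cantor_set k C \<longleftrightarrow>
     (\<exists>h g. homeomorphism UNIV UNIV h g \<and> Cantor_set (h ` C) \<and> h ` C \<subseteq> coordinate_line k)"

definition sigma_C0 :: "'n::finite \<Rightarrow> (real ^ 'n) set set" where
  "sigma_C0 k = {A. \<exists>\<C>. countable \<C> \<and> (\<forall>C\<in>\<C>. tame_Cantor_set k C) \<and> A \<subseteq> \<Union>\<C>}"

lemma separable_metric_inj:
  assumes "metrizable_space T" "separable_space T"
  shows "\<exists>g :: 'b \<Rightarrow> nat \<Rightarrow> real. inj_on g (topspace T)"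
proof -
  obtain M d where M: "Metric_space M d" and T: "T = Metric_space.mtopology M d"
    using assms(1) unfolding metrizable_space_def by blast
  interpret Metric_space M d by (rule M)
  obtain D where D: "countable D" "D \<subseteq> M" "mtopology closure_of D = M"
    using assms(2) unfolding separable_space_def T by auto
  define g where "g = (\<lambda>x n. d x (from_nat_into D n))"
  have "x = y" if x: "x \<in> M" and y: "y \<in> M" and eq: "g x = g y" for x y
  proof (rule ccontr)
    assume "x \<noteq> y"
    then have pos: "d x y / 2 > 0" using x y by simp
    have "x \<in> mtopology closure_of D" using D x by simp
    then obtain z where z: "z \<in> D" "d x z < d x y / 2"
      unfolding metric_closure_of using pos unfolding mball_def mem_Collect_eq by blast
    obtain n where "from_nat_into D n = z"
      using from_nat_into_surj[OF D(1) z(1)] by blast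
    then have "d x z = d y z" using fun_cong[OF eq, of n] by (simp add: g_def)
    moreover have "d x y \<le> d x z + d z y" using triangle x y z D by blast
    ultimately show False using z(2) commute[of z y] by linarith
  qed
  then show ?thesis unfolding T by (auto simp: inj_on_def)
qed

lemma analytic_setI:
  fixes T :: "'b topology" and f :: "'b \<Rightarrow> 'a::topological_space"
  assumes T: "Polish_space T" and f: "continuous_map T euclidean f"
  shows "analytic_set (f ` topspace T)"
proof -
  obtain g :: "'b \<Rightarrow> nat \<Rightarrow> real" where g: "inj_on g (topspace T)"
    using T separable_metric_inj completely_metrizable_imp_metrizable_space
    unfolding Polish_space_def by metis
  define k where "k = inv_into (topspace T) g"
  define T' where "T' = pullback_topology (g ` topspace T) k T"
  have kg: "k (g x) = x" if "x \<in> topspace T" for x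
    using g that by (simp add: k_def)
  have top: "topspace T' = g ` topspace T"
    by (auto simp: T'_def topspace_pullback_topology kg)
  have k: "continuous_map T' T k"
    using continuous_map_pullback[OF continuous_map_id] by (simp add: T'_def)
  have "continuous_map T T' g"
    unfolding T'_def
    by (rule continuous_map_pullback') (auto simp: kg intro: continuous_map_eq[OF continuous_map_id])
  then have "homeomorphic_maps T T' g k"
    using k kg top unfolding homeomorphic_maps_def by auto
  then have hom: "T homeomorphic_space T'"
    unfolding homeomorphic_space_def by blast
  then have "Polish_space T'"
    using T homeomorphic_completely_metrizable_space homeomorphic_separable_space
    unfolding Polish_space_def by blast
  moreover have "continuous_map T' euclidean (f \<circ> k)"
    using k f by (rule continuous_map_compose)
  moreover have "f ` topspace T = (f \<circ> k) ` topspace T'"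
    by (auto simp: top image_image kg)
  ultimately show ?thesis
    unfolding analytic_set_def by blast
qed

lemma sigma_ideal_sigma_C0: "sigma_ideal UNIV (sigma_C0 k)"
proof -
  have c: "\<Union>\<A> \<in> sigma_C0 k" if "countable \<A>" "\<A> \<subseteq> sigma_C0 k" for \<A>
  proof -
    have "\<forall>A\<in>\<A>. \<exists>\<C>. countable \<C> \<and> (\<forall>C\<in>\<C>. tame_Cantor_set k C) \<and> A \<subseteq> \<Union>\<C>"
      using that unfolding sigma_C0_def by blast
    then obtain F where F: "\<forall>A\<in>\<A>. countable (F A) \<and> (\<forall>C\<in>F A. tame_Cantor_set k C) \<and> A \<subseteq> \<Union>(F A)"
      by metis
    have "countable (\<Union>(F ` \<A>))" using that F by simp
    moreover have "\<forall>C\<in>\<Union>(F ` \<A>). tame_Cantor_set k C" using F by blast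
    moreover have "\<Union>\<A> \<subseteq> \<Union>(\<Union>(F ` \<A>))"
    proof
      fix x assume "x \<in> \<Union>\<A>"
      then obtain A where A: "A \<in> \<A>" "x \<in> A" by (rule UnionE)
      then have "x \<in> \<Union>(F A)" using F by (meson subsetD)
      then show "x \<in> \<Union>(\<Union>(F ` \<A>))" using A(1) by (meson UN_I UnionE UnionI)
    qed
    ultimately show ?thesis unfolding sigma_C0_def by blast
  qed
  have d: "B \<in> sigma_C0 k" if "A \<in> sigma_C0 k" "B \<subseteq> A" for A B
    using that unfolding sigma_C0_def mem_Collect_eq by (meson subset_trans)
  have "{} \<in> sigma_C0 k" using c[of "{}"] by simp
  then have "sigma_C0 k \<noteq> {}" by (metis empty_iff)
  then have "set_ideal UNIV (sigma_C0 k)"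
    unfolding set_ideal_def using c d by (simp add: countable_finite)
  then show ?thesis
    unfolding sigma_ideal_def using c by simp
qed

end

theory Submission
  imports Defs
begin

text \<open>
  Let \<open>B \<in> \<I>\<close> be analytic and uncountable, and let \<open>E\<close> be a Cantor set in \<open>\<real>\<close>, viewed as a subset of the
  \<open>k\<close>-th axis. Some coordinate projection of \<open>B\<close>, say the \<open>i\<close>-th, is uncountable. A Cantor scheme in
  the Polish space parametrising \<open>B\<close>, indexed by binary expansions, gives a map of the irrationals
  of \<open>(0, 1)\<close> into \<open>B\<close> that is continuous and has strictly increasing \<open>i\<close>-th coordinate. By Baire
  category \<open>E\<close> can be moved affinely into these irrationals, so there is a continuous
  \<open>\<gamma> : E \<rightarrow> B\<close> with \<open>\<gamma>\<^sub>i\<close> strictly increasing. Interpolating \<open>\<gamma>\<^sub>i\<close> linearly on the gaps of \<open>E\<close>,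
  extending the other coordinates by Tietze, and shearing gives a homeomorphism of \<open>\<real>\<^sup>n\<close> that
  extends \<open>\<gamma>\<close>. Hence \<open>\<I>\<close> contains \<open>E\<close> on the axis by invariance, and with it every tame Cantor set.
\<close>

section \<open>Extending increasing maps to homeomorphisms\<close>

text \<open>A monotone map with open image has no jumps; this applies to \<open>h\<close> and to its
  inverse.\<close>

lemma strict_mono_surj_homeomorphism:
  fixes h :: "real \<Rightarrow> real"
  assumes "strict_mono h" "surj h"
  shows "homeomorphism UNIV UNIV h (inv h)"
proof -
  have inj: "inj h" using assms(1) by (rule strict_mono_imp_inj_on)
  have "surj (inv h)" using inj by (rule inj_imp_surj_inv)
  have inv_mono: "inv h x \<le> inv h y" if "x \<le> y" for x y
    using that strict_mono_less_eq[OF assms(1)] surj_f_inv_f[OF assms(2)] by metis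
  have "continuous_on UNIV h"
    by (rule continuous_onI_mono) (use assms strict_mono_less_eq in auto)
  moreover have "continuous_on UNIV (inv h)"
    by (rule continuous_onI_mono) (use \<open>surj (inv h)\<close> inv_mono in auto)
  ultimately show ?thesis
    using assms(2) inj \<open>surj (inv h)\<close>
    by (auto simp: homeomorphism_def surj_f_inv_f)
qed

text \<open>Interpolate linearly on the gaps of \<open>E\<close>. As \<open>E\<close> is unbounded
  both ways, every gap is bounded with both ends in \<open>E\<close>; as the values of
  \<open>\<psi>\<close> are unbounded both ways, the extension is onto. Continuity of
  \<open>h\<close> is then automatic.\<close>

lemma strict_mono_extension_unbounded:
  fixes \<psi> :: "real \<Rightarrow> real"
  assumes E: "closed E" and lower: "\<And>x. \<exists>e\<in>E. e \<le> x" and upper: "\<And>x. \<exists>e\<in>E. x \<le> e"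
    and cont: "continuous_on E \<psi>" and mono: "strict_mono_on E \<psi>"
    and \<psi>_lower: "\<And>y. \<exists>e\<in>E. \<psi> e \<le> y" and \<psi>_upper: "\<And>y. \<exists>e\<in>E. y \<le> \<psi> e"
  obtains h where "strict_mono h" "surj h" "\<And>e. e \<in> E \<Longrightarrow> h e = \<psi> e"
proof -
  \<comment> \<open>For \<open>x\<close> off \<open>E\<close>, these are the ends of the gap around
    \<open>x\<close>: the nearest points of \<open>E\<close> on the left and on the right.\<close>
  define a b where "a x = Sup (E \<inter> {..x})" and "b x = Inf (E \<inter> {x..})" for x
  define h where "h x = (if x \<in> E then \<psi> x
    else \<psi> (a x) + (x - a x) / (b x - a x) * (\<psi> (b x) - \<psi> (a x)))" for x
  \<comment> \<open>The gap ends as a relation, so that two points of one gap visibly share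
    \<open>p\<close> and \<open>q\<close>.\<close>
  define gap where "gap p q x \<longleftrightarrow> p \<in> E \<and> q \<in> E \<and> p < x \<and> x < q \<and> E \<inter> {p<..<q} = {}" for p q x
  have gap_h: "h x = \<psi> p + (x - p) / (q - p) * (\<psi> q - \<psi> p)" if "gap p q x" for p q x
  proof -
    have "x \<notin> E" using that by (auto simp: gap_def)
    moreover have "a x = p"
      unfolding a_def by (rule cSup_eq_maximum) (use that in \<open>force simp: gap_def\<close>)+
    moreover have "b x = q"
      unfolding b_def by (rule cInf_eq_minimum) (use that in \<open>force simp: gap_def\<close>)+
    ultimately show ?thesis by (simp add: h_def)
  qed
  have gap_ex: "\<exists>p q. gap p q x" if "x \<notin> E" for x
  proof -
    have "a x \<in> E \<inter> {..x}"
      unfolding a_def using lower[of x] E by (intro closed_contains_Sup) auto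
    moreover have "b x \<in> E \<inter> {x..}"
      unfolding b_def using upper[of x] E by (intro closed_contains_Inf) auto
    moreover have "e \<le> a x" if "e \<in> E" "e \<le> x" for e
      unfolding a_def using that by (intro cSup_upper) auto
    moreover have "b x \<le> e" if "e \<in> E" "x \<le> e" for e
      unfolding b_def using that by (intro cInf_lower) auto
    moreover have "a x \<noteq> x" "b x \<noteq> x" using calculation(1,2) that by auto
    ultimately have "gap (a x) (b x) x"
      unfolding gap_def by (smt (verit) IntE atMost_iff atLeast_iff disjoint_iff greaterThanLessThan_iff)
    then show ?thesis by blast
  qed
  have gap_less: "\<psi> p < h x \<and> h x < \<psi> q" if "gap p q x" for p q x
  proof -
    have "\<psi> p < \<psi> q" using that mono by (auto simp: gap_def strict_mono_on_def)
    moreover have "0 < (x - p) / (q - p)" "(x - p) / (q - p) < 1" using that by (auto simp: gap_def)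
    ultimately have "0 < (x - p) / (q - p) * (\<psi> q - \<psi> p)"
      "(x - p) / (q - p) * (\<psi> q - \<psi> p) < 1 * (\<psi> q - \<psi> p)"
      by (intro mult_pos_pos mult_strict_right_mono; simp)+
    then show ?thesis using gap_h[OF that] by simp
  qed
  have le: "\<psi> d \<le> \<psi> e" if "d \<in> E" "e \<in> E" "d \<le> e" for d e
    using strict_mono_on_leD[OF mono] that by blast
  have below: "h x < \<psi> e" if "e \<in> E" "x < e" for x e
  proof (cases "x \<in> E")
    case True then show ?thesis using that mono by (simp add: h_def strict_mono_on_def)
  next
    case False
    then obtain p q where g: "gap p q x" using gap_ex by blast
    then have "q \<le> e" using that unfolding gap_def by (smt (verit) disjoint_iff greaterThanLessThan_iff)
    then show ?thesis using gap_less[OF g] le[of q e] g that(1) by (simp add: gap_def)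
  qed
  have above: "\<psi> e < h x" if "e \<in> E" "e < x" for x e
  proof (cases "x \<in> E")
    case True then show ?thesis using that mono by (simp add: h_def strict_mono_on_def)
  next
    case False
    then obtain p q where g: "gap p q x" using gap_ex by blast
    then have "e \<le> p" using that unfolding gap_def by (smt (verit) disjoint_iff greaterThanLessThan_iff)
    then show ?thesis using gap_less[OF g] le[of e p] g that(1) by (simp add: gap_def)
  qed
  \<comment> \<open>Either a point of \<open>E\<close> lies between \<open>x\<close> and
    \<open>y\<close> and both values are compared with its value, or both points lie in one gap,
    where \<open>h\<close> is affine with positive slope.\<close>
  have "h x < h y" if "x < y" for x y
  proof (cases "\<exists>e\<in>E. x \<le> e \<and> e \<le> y")
    case True
    then obtain e where e: "e \<in> E" "x \<le> e" "e \<le> y" by blast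
    then have "h x \<le> \<psi> e" "\<psi> e \<le> h y" "h x < \<psi> e \<or> \<psi> e < h y"
      using below[of e x] above[of e y] that by (cases "x = e"; cases "y = e"; force simp: h_def)+
    then show ?thesis by linarith
  next
    case False
    then have "x \<notin> E" using that by auto
    then obtain p q where g: "gap p q x" using gap_ex by blast
    then have g': "gap p q y" using that False unfolding gap_def by force
    have "0 < (\<psi> q - \<psi> p) / (q - p)"
      using g mono by (auto simp: gap_def strict_mono_on_def)
    then have "(x - p) * ((\<psi> q - \<psi> p) / (q - p)) < (y - p) * ((\<psi> q - \<psi> p) / (q - p))"
      using that by (intro mult_strict_right_mono) auto
    then show ?thesis using gap_h[OF g] gap_h[OF g'] by simp
  qed
  then have "strict_mono h" by (simp add: strict_mono_def)
  moreover have "\<exists>x. h x = y" for y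
  proof -
    \<comment> \<open>Both sets are closed since \<open>\<psi>\<close> is continuous on
      \<open>E\<close>, so \<open>A\<close> has a maximum \<open>p\<close> and \<open>B\<close> a
      minimum \<open>q\<close>. If \<open>y\<close> is not a value of \<open>\<psi>\<close> at
      \<open>p\<close> or \<open>q\<close>, these points bound a gap on which \<open>h\<close> takes
      the value \<open>y\<close>.\<close>
    define A B where "A = {e\<in>E. \<psi> e \<le> y}" and "B = {e\<in>E. y \<le> \<psi> e}"
    obtain l u where l: "l \<in> E" "\<psi> l \<le> y" and u: "u \<in> E" "y \<le> \<psi> u"
      using \<psi>_lower \<psi>_upper by metis
    have less: "d \<le> e" if "d \<in> E" "e \<in> E" "\<psi> d \<le> \<psi> e" for d e
      using that mono by (metis strict_mono_onD linorder_not_less)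
    have "closed A" "closed B"
      unfolding A_def B_def using E cont
      by (auto intro!: continuous_closed_preimage[of E \<psi> "{..y}", simplified vimage_def Int_def, simplified]
          continuous_closed_preimage[of E \<psi> "{y..}", simplified vimage_def Int_def, simplified])
    moreover have "bdd_above A"
      using less[OF _ u(1)] u(2) by (intro bdd_aboveI[of _ u]) (auto simp: A_def)
    moreover have "bdd_below B"
      using less[OF l(1)] l(2) by (intro bdd_belowI[of _ l]) (auto simp: B_def)
    moreover have "l \<in> A" "u \<in> B" using l u by (auto simp: A_def B_def)
    ultimately have pA: "Sup A \<in> A" and qB: "Inf B \<in> B"
      and pmax: "\<And>e. e \<in> A \<Longrightarrow> e \<le> Sup A" and qmin: "\<And>e. e \<in> B \<Longrightarrow> Inf B \<le> e"
      by (auto intro: closed_contains_Sup closed_contains_Inf cSup_upper cInf_lower)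
    define p q where "p = Sup A" and "q = Inf B"
    show ?thesis
    proof (cases "\<psi> p = y \<or> \<psi> q = y")
      case True
      then show ?thesis using pA qB by (auto simp: A_def B_def p_def q_def h_def)
    next
      case False
      then have y: "\<psi> p < y" "y < \<psi> q" and pq: "p \<in> E" "q \<in> E"
        using pA qB by (auto simp: A_def B_def p_def q_def)
      then have "p < q" using less[of p q] by (cases "p = q") auto
      \<comment> \<open>The solution of \<open>h x = y\<close> for the affine formula on the
        gap.\<close>
      define x where "x = p + (y - \<psi> p) / (\<psi> q - \<psi> p) * (q - p)"
      have "0 < (y - \<psi> p) / (\<psi> q - \<psi> p)" "(y - \<psi> p) / (\<psi> q - \<psi> p) < 1" using y by auto
      then have "0 < (y - \<psi> p) / (\<psi> q - \<psi> p) * (q - p)"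
        "(y - \<psi> p) / (\<psi> q - \<psi> p) * (q - p) < 1 * (q - p)"
        using \<open>p < q\<close> by (intro mult_pos_pos mult_strict_right_mono; simp)+
      moreover have "E \<inter> {p<..<q} = {}"
      proof -
        have "e \<le> p \<or> q \<le> e" if "e \<in> E" for e
          using that pmax[of e] qmin[of e] by (cases "\<psi> e \<le> y") (auto simp: A_def B_def p_def q_def)
        then show ?thesis by force
      qed
      ultimately have "gap p q x" using pq by (auto simp: gap_def x_def)
      then have "h x = \<psi> p + (x - p) / (q - p) * (\<psi> q - \<psi> p)" by (rule gap_h)
      also have "\<dots> = y" using \<open>p < q\<close> y by (simp add: x_def)
      finally show ?thesis by blast
    qed
  qed
  then have "surj h" by (metis surjI)
  ultimately show thesis using that by (simp add: h_def)
qed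

text \<open>Adding a ray of slope 1 on either side of \<open>E\<close> reduces this to the unbounded
  case.\<close>

lemma strict_mono_extension_compact:
  fixes \<psi> :: "real \<Rightarrow> real"
  assumes E: "compact E" and cont: "continuous_on E \<psi>" and mono: "strict_mono_on E \<psi>"
  obtains h where "strict_mono h" "surj h" "\<And>e. e \<in> E \<Longrightarrow> h e = \<psi> e"
proof (cases "E = {}")
  case True
  then show thesis using that[of id] by (simp add: strict_mono_def)
next
  case False
  then obtain l u where l: "l \<in> E" "\<And>e. e \<in> E \<Longrightarrow> l \<le> e" and u: "u \<in> E" "\<And>e. e \<in> E \<Longrightarrow> e \<le> u"
    using compact_attains_inf[OF E] compact_attains_sup[OF E] by metis
  define \<psi>' where "\<psi>' x = (if x \<le> l then \<psi> l + (x - l) else if u \<le> x then \<psi> u + (x - u) else \<psi> x)" for x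
  have \<psi>': "\<psi>' e = \<psi> e" if "e \<in> E" for e
    using that l u by (force simp: \<psi>'_def)
  have le: "\<psi> d \<le> \<psi> e" if "d \<in> E" "e \<in> E" "d \<le> e" for d e
    using strict_mono_on_leD[OF mono] that by blast
  \<comment> \<open>The last clause covers a one-point \<open>E\<close>, the only case where the two
    rays meet; their formulas agree there.\<close>
  have lu: "l \<le> u" "\<psi> l \<le> \<psi> u" "\<And>x. u \<le> x \<Longrightarrow> x \<le> l \<Longrightarrow> x = l \<and> u = l"
    using l u le by force+
  have \<psi>'_upper: "\<psi>' x = \<psi> u + (x - u)" if "u \<le> x" for x
    using that lu(3)[of x] by (auto simp: \<psi>'_def)
  have "closed (E \<union> ({..l} \<union> {u..}))"
    using compact_imp_closed[OF E] by (intro closed_Un) auto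
  moreover have "\<exists>e\<in>E \<union> ({..l} \<union> {u..}). e \<le> x" for x
    by (rule bexI[of _ "min x l"]) auto
  moreover have "\<exists>e\<in>E \<union> ({..l} \<union> {u..}). x \<le> e" for x
    by (rule bexI[of _ "max x u"]) auto
  moreover have "continuous_on (E \<union> ({..l} \<union> {u..})) \<psi>'"
  proof (intro continuous_on_closed_Un)
    show "continuous_on E \<psi>'" using cont \<psi>' by (simp cong: continuous_on_cong)
    have "continuous_on {..l} (\<lambda>x. \<psi> l + (x - l))" by (intro continuous_intros)
    then show "continuous_on {..l} \<psi>'" by (rule continuous_on_eq) (simp add: \<psi>'_def)
    have "continuous_on {u..} (\<lambda>x. \<psi> u + (x - u))" by (intro continuous_intros)
    then show "continuous_on {u..} \<psi>'"
      by (rule continuous_on_eq) (simp add: \<psi>'_upper)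
  qed (use compact_imp_closed[OF E] in \<open>auto intro: closed_Un\<close>)
  moreover have "strict_mono_on (E \<union> ({..l} \<union> {u..})) \<psi>'"
  proof (rule strict_mono_onI)
    fix x y assume xy: "x \<in> E \<union> ({..l} \<union> {u..})" "y \<in> E \<union> ({..l} \<union> {u..})" "x < y"
    consider "y \<le> l" | "u \<le> x" | "x \<le> l" "u \<le> y" | "x \<le> l" "y \<in> E" | "x \<in> E" "u \<le> y"
      | "x \<in> E" "y \<in> E"
      using xy by force
    then show "\<psi>' x < \<psi>' y"
    proof cases
      case 3
      then show ?thesis using lu xy(3) strict_mono_onD[OF mono l(1) u(1)]
        by (cases "l = u") (auto simp: \<psi>'_def)
    next
      case 4
      then show ?thesis using \<psi>'[of y] le[of l y] l xy(3) strict_mono_onD[OF mono, of l y]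
        by (cases "x = l") (auto simp: \<psi>'_def)
    next
      case 5
      then have "\<psi>' y = \<psi> u + (y - u)" by (simp add: \<psi>'_upper)
      moreover have "\<psi>' x = \<psi> x" using \<psi>' 5 by simp
      moreover have "x < u \<Longrightarrow> \<psi> x < \<psi> u" using strict_mono_onD[OF mono _ u(1)] 5 by simp
      moreover have "x \<le> u" using u 5 by simp
      ultimately show ?thesis using 5 xy(3) by (cases "x = u") auto
    next
      case 6
      then show ?thesis using \<psi>' xy(3) strict_mono_onD[OF mono] by auto
    qed (use lu xy(3) in \<open>auto simp: \<psi>'_def\<close>)
  qed
  moreover have "\<exists>e\<in>E \<union> ({..l} \<union> {u..}). \<psi>' e \<le> y" for y
    \<comment> \<open>The left ray solves for \<open>y\<close>; the minimum with \<open>l\<close>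
      keeps the witness on that ray.\<close>
    by (rule bexI[of _ "min l (l + (y - \<psi> l))"]) (auto simp: \<psi>'_def)
  moreover have "\<exists>e\<in>E \<union> ({..l} \<union> {u..}). y \<le> \<psi>' e" for y
    by (rule bexI[of _ "max u (u + (y - \<psi> u))"]) (auto simp: \<psi>'_upper)
  ultimately obtain h where "strict_mono h" "surj h" "\<And>e. e \<in> E \<union> ({..l} \<union> {u..}) \<Longrightarrow> h e = \<psi>' e"
    by (rule strict_mono_extension_unbounded) blast
  then show thesis using that \<psi>' by simp
qed

text \<open>The \<open>i\<close>-th output coordinate \<open>h (x $ k)\<close> determines the
  parameter \<open>x $ k\<close>, so a translation of the other coordinates depending on that
  parameter can be undone.\<close>

lemma homeomorphism_axis_to_curve:
  fixes \<gamma> :: "real \<Rightarrow> real ^ 'n" and i k :: 'n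
  assumes E: "compact E" and cont: "continuous_on E \<gamma>" and mono: "strict_mono_on E (\<lambda>t. \<gamma> t $ i)"
  obtains H G where "homeomorphism UNIV UNIV H G" "\<And>t. t \<in> E \<Longrightarrow> H (axis k t) = \<gamma> t"
proof -
  obtain h where h: "strict_mono h" "surj h" "\<And>e. e \<in> E \<Longrightarrow> h e = \<gamma> e $ i"
    by (rule strict_mono_extension_compact[OF E _ mono]) (use cont in \<open>auto intro: continuous_intros\<close>)
  then have hom: "homeomorphism UNIV UNIV h (inv h)"
    by (intro strict_mono_surj_homeomorphism)
  have "closedin (top_of_set UNIV) E" using E by (simp add: compact_imp_closed)
  \<comment> \<open>Off \<open>E\<close> the \<open>i\<close>-th coordinate of
    \<open>\<Gamma>\<close> need not be increasing; therefore \<open>H\<close> uses \<open>h\<close>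
    in that slot.\<close>
  then obtain \<Gamma> where \<Gamma>: "continuous_on UNIV \<Gamma>" "\<And>t. t \<in> E \<Longrightarrow> \<Gamma> t = \<gamma> t"
    using Tietze_unbounded[OF cont] by blast
  \<comment> \<open>The swap puts the parameter, read from slot \<open>k\<close>, into slot
    \<open>i\<close>, and moves the old \<open>i\<close>-th coordinate to slot \<open>k\<close>. On
    the \<open>k\<close>-th axis every \<open>x $ \<sigma> j\<close> with
    \<open>j \<noteq> i\<close> is 0.\<close>
  define \<sigma> where "\<sigma> = Transposition.transpose i k"
  define H :: "real ^ 'n \<Rightarrow> real ^ 'n"
    where "H x = (\<chi> j. if j = i then h (x $ k) else x $ \<sigma> j + \<Gamma> (x $ k) $ j)" for x
  define G :: "real ^ 'n \<Rightarrow> real ^ 'n"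
    where "G z = (\<chi> j. if j = k then inv h (z $ i) else z $ \<sigma> j - \<Gamma> (inv h (z $ i)) $ \<sigma> j)" for z
  have c: "continuous_on UNIV h" "continuous_on UNIV (inv h)"
    using hom by (auto simp: homeomorphism_def)
  have inv: "inv h (h x) = x" "h (inv h x) = x" for x
    using hom by (auto simp: homeomorphism_def)
  have \<sigma>: "\<sigma> i = k" "\<sigma> k = i" "\<sigma> (\<sigma> j) = j" "\<sigma> j = k \<longleftrightarrow> j = i" "\<sigma> j = i \<longleftrightarrow> j = k" for j
    by (auto simp: \<sigma>_def Transposition.transpose_def)
  have "continuous_on UNIV H"
    unfolding H_def
    by (rule continuous_on_vec_lambda, rule_tac P = "j = i" in case_split)
      (auto intro!: continuous_intros continuous_on_compose2[OF c(1)] continuous_on_compose2[OF \<Gamma>(1)])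
  moreover have "continuous_on UNIV G"
    unfolding G_def
    by (rule continuous_on_vec_lambda, rule_tac P = "j = k" in case_split)
      (auto intro!: continuous_intros continuous_on_compose2[OF c(2)] continuous_on_compose2[OF \<Gamma>(1)])
  moreover have "G (H x) = x" "H (G x) = x" for x
    by (auto simp: vec_eq_iff G_def H_def inv \<sigma>)
  ultimately have "homeomorphism UNIV UNIV H G"
    by (intro homeomorphismI) auto
  moreover have "H (axis k t) = \<gamma> t" if "t \<in> E" for t
    using that h(3) \<Gamma>(2) by (auto simp: vec_eq_iff H_def \<sigma> axis_def)
  ultimately show thesis by (rule that)
qed

section \<open>A Cantor scheme with increasing values\<close>

lemma (in Metric_space) openin_contains_small_mcball:
  assumes "openin mtopology W" "x \<in> W" "\<epsilon> > 0"
  obtains r where "0 < r" "r \<le> \<epsilon>" "mcball x r \<subseteq> W"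
proof -
  obtain r where "0 < r" "mcball x r \<subseteq> W"
    using assms(1,2) by (auto simp: openin_mtopology_mcball)
  then show thesis
    using assms(3) mcball_subset_concentric[of "min r \<epsilon>" r x] by (intro that[of "min r \<epsilon>"]) auto
qed

text \<open>A Lindelof argument: countably many balls, with centres in a countable dense set and
  radii \<open>1 / (n + 1)\<close>, have countable image and cover \<open>S\<close>.\<close>

lemma (in Metric_space) countable_image_of_locally_countable:
  assumes sep: "separable_space mtopology"
    and loc: "\<And>x. x \<in> S \<Longrightarrow> \<exists>V. openin mtopology V \<and> x \<in> V \<and> countable (\<phi> ` V)"
  shows "countable (\<phi> ` S)"
proof -
  obtain D where D: "countable D" "D \<subseteq> M" "mtopology closure_of D = M"
    using sep by (auto simp: separable_space_def)
  define W where "W j = mball (fst j) (1 / real (Suc (snd j)))" for j :: "'a \<times> nat"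
  define J where "J = {j \<in> D \<times> (UNIV :: nat set). countable (\<phi> ` W j)}"
  have "J \<subseteq> D \<times> UNIV" by (auto simp: J_def)
  then have "countable J" using D(1) by (meson countable_SIGMA countableI_type countable_subset)
  have "S \<subseteq> (\<Union>j\<in>J. W j)"
  proof
    fix x assume "x \<in> S"
    then obtain V where V: "openin mtopology V" "x \<in> V" "countable (\<phi> ` V)" using loc by blast
    then have "V \<subseteq> M" "\<exists>r>0. mball x r \<subseteq> V" by (simp_all add: openin_mtopology)
    with V(2) obtain r where r: "0 < r" "mball x r \<subseteq> V" and x: "x \<in> M" by blast
    obtain n :: nat where n: "1 / Suc n < r / 2"
      using r(1) nat_approx_posE[of "r / 2"] by auto
    have "x \<in> mtopology closure_of D" using D x by simp
    moreover have "0 < 1 / real (Suc n)" by simp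
    ultimately obtain z where z: "z \<in> D" "z \<in> mball x (1 / Suc n)"
      unfolding metric_closure_of mem_Collect_eq by blast
    have "mball z (1 / Suc n) \<subseteq> mball x r"
      using z n x commute[of x z] by (intro mball_subset) auto
    then have "countable (\<phi> ` W (z, n))"
      using r(2) V(3) by (auto simp: W_def intro: countable_subset[OF image_mono])
    then have "(z, n) \<in> J" using z(1) by (simp add: J_def)
    moreover have "x \<in> W (z, n)" using z x D(2) commute[of x z] by (auto simp: W_def)
    ultimately show "x \<in> (\<Union>j\<in>J. W j)" by blast
  qed
  then have "\<phi> ` S \<subseteq> (\<Union>j\<in>J. \<phi> ` W j)" unfolding image_UN[symmetric] by (rule image_mono)
  moreover have "countable (\<Union>j\<in>J. \<phi> ` W j)"
    using \<open>countable J\<close> by (rule countable_UN) (simp add: J_def)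
  ultimately show ?thesis by (rule countable_subset)
qed

text \<open>Discard the countably many values taken at points with a neighbourhood of countable
  image. Two distinct remaining values come from points all of whose balls have uncountable image,
  and small balls around them are separated by the midpoint of the values.\<close>

lemma (in Metric_space) uncountable_image_split:
  fixes \<phi> :: "'a \<Rightarrow> real"
  assumes sep: "separable_space mtopology" and cont: "continuous_map mtopology euclideanreal \<phi>"
    and U: "openin mtopology U" "uncountable (\<phi> ` U)" and "\<epsilon> > 0"
  obtains a b r s where "r \<le> \<epsilon>" "s \<le> \<epsilon>" "mcball a r \<subseteq> U" "mcball b s \<subseteq> U"
    "uncountable (\<phi> ` mball a r)" "uncountable (\<phi> ` mball b s)"
    "\<And>x y. x \<in> mcball a r \<Longrightarrow> y \<in> mcball b s \<Longrightarrow> \<phi> x < \<phi> y"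
proof -
  define N where "N = {x\<in>U. \<exists>V. openin mtopology V \<and> x \<in> V \<and> countable (\<phi> ` V)}"
  have "countable (\<phi> ` N)"
    by (rule countable_image_of_locally_countable[OF sep]) (auto simp: N_def)
  then have unc: "uncountable (\<phi> ` U - \<phi> ` N)" by (rule uncountable_minus_countable[OF U(2)])
  then obtain u where u: "u \<in> \<phi> ` U - \<phi> ` N" by (metis all_not_in_conv countable_empty)
  have "uncountable (\<phi> ` U - \<phi> ` N - {u})" using unc by (simp add: uncountable_minus_countable)
  then obtain v where v: "v \<in> \<phi> ` U - \<phi> ` N - {u}" by (metis all_not_in_conv countable_empty)
  obtain a' b' where "a' \<in> U - N" "u = \<phi> a'" "b' \<in> U - N" "v = \<phi> b'" "\<phi> a' \<noteq> \<phi> b'"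
    using u v by auto
  then obtain a b where a: "a \<in> U - N" and b: "b \<in> U - N" and ab: "\<phi> a < \<phi> b"
    by (cases "\<phi> a'" "\<phi> b'" rule: linorder_cases) simp_all
  define m where "m = (\<phi> a + \<phi> b) / 2"
  have m: "\<phi> a < m" "m < \<phi> b" using ab by (auto simp: m_def)
  have sub: "U \<subseteq> M" using U(1) openin_subset by fastforce
  have "openin mtopology {x \<in> topspace mtopology. \<phi> x \<in> {..<m}}"
    "openin mtopology {x \<in> topspace mtopology. \<phi> x \<in> {m<..}}"
    by (rule openin_continuous_map_preimage[OF cont]; simp)+
  then have op: "openin mtopology (U \<inter> {x \<in> topspace mtopology. \<phi> x \<in> {..<m}})"
    "openin mtopology (U \<inter> {x \<in> topspace mtopology. \<phi> x \<in> {m<..}})"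
    using U(1) by (auto intro: openin_Int)
  have mem: "a \<in> U \<inter> {x \<in> topspace mtopology. \<phi> x \<in> {..<m}}"
    "b \<in> U \<inter> {x \<in> topspace mtopology. \<phi> x \<in> {m<..}}"
    using a b m sub by auto
  obtain r where r: "0 < r" "r \<le> \<epsilon>" "mcball a r \<subseteq> U \<inter> {x \<in> topspace mtopology. \<phi> x \<in> {..<m}}"
    by (rule openin_contains_small_mcball[OF op(1) mem(1) \<open>\<epsilon> > 0\<close>])
  obtain s where s: "0 < s" "s \<le> \<epsilon>" "mcball b s \<subseteq> U \<inter> {x \<in> topspace mtopology. \<phi> x \<in> {m<..}}"
    by (rule openin_contains_small_mcball[OF op(2) mem(2) \<open>\<epsilon> > 0\<close>])
  have "uncountable (\<phi> ` mball c t)" if "c \<in> U - N" "t > 0" for c t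
  proof -
    have "c \<in> mball c t" using that sub by auto
    then show ?thesis using that(1) openin_mball[of c t] unfolding N_def by blast
  qed
  then have "uncountable (\<phi> ` mball a r)" "uncountable (\<phi> ` mball b s)"
    using a b r(1) s(1) by simp_all
  moreover have "\<phi> x < \<phi> y" if "x \<in> mcball a r" "y \<in> mcball b s" for x y
  proof -
    have "\<phi> x < m" "m < \<phi> y" using r(3) s(3) that by blast+
    then show ?thesis by linarith
  qed
  moreover have "mcball a r \<subseteq> U" "mcball b s \<subseteq> U" using r(3) s(3) by auto
  ultimately show thesis using that[of r s a b] r(2) s(2) by simp
qed

text \<open>The floor of \<open>2 ^ n * y\<close> encodes the integer part and the first
  \<open>n\<close> binary digits of \<open>y\<close>; halving drops the last digit.\<close>

lemma floor_dyadic_div_2: "\<lfloor>2 ^ Suc n * y\<rfloor> div 2 = \<lfloor>2 ^ n * (y::real)\<rfloor>"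
proof -
  have "\<lfloor>2 ^ Suc n * y\<rfloor> div 2 = \<lfloor>(2 ^ Suc n * y) / real_of_int 2\<rfloor>"
    by (rule floor_divide_real_eq_div[symmetric]) simp
  then show ?thesis by simp
qed

lemma dyadic_separation:
  fixes y y' :: real
  assumes "y < y'"
  shows "\<exists>n. \<lfloor>2 ^ n * y\<rfloor> \<noteq> \<lfloor>2 ^ n * y'\<rfloor>"
proof -
  obtain n where "1 / (y' - y) < 2 ^ n" using real_arch_pow[of 2] by auto
  then have "1 < 2 ^ n * y' - 2 ^ n * y" using assms by (simp add: field_simps)
  then have "\<lfloor>2 ^ n * y\<rfloor> \<noteq> \<lfloor>2 ^ n * y'\<rfloor>" by linarith
  then show ?thesis by blast
qed

text \<open>At an irrational point this makes each initial block of binary digits locally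
  constant.\<close>

lemma eventually_floor_mult_eq:
  fixes y c :: real
  assumes "c * y \<notin> \<int>"
  shows "\<forall>\<^sub>F x in at y. \<lfloor>c * x\<rfloor> = \<lfloor>c * y\<rfloor>"
proof -
  have "isCont (\<lambda>x. c * x) y" by (intro continuous_intros)
  then have "((\<lambda>x. c * x) \<longlongrightarrow> c * y) (at y)" by (simp add: isCont_def)
  then show ?thesis using assms by (intro eventually_floor_eq)
qed

text \<open>
  The points \<open>g y\<close> are the branches of a Cantor scheme, the branch of \<open>y\<close> following the binary digits
  of \<open>y\<close>. Indexing by reals instead of 0-1 sequences makes \<open>\<phi> \<circ> g\<close> increasing at the price of
  continuity at dyadic rationals.
\<close>
lemma (in Metric_space) increasing_transversal:
  fixes \<phi> :: "'a \<Rightarrow> real"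
  assumes compl: mcomplete and sep: "separable_space mtopology"
    and cont: "continuous_map mtopology euclideanreal \<phi>" and unc: "uncountable (\<phi> ` M)"
  obtains g where "\<And>y. y \<in> {0<..<1::real} \<Longrightarrow> g y \<in> M"
    and "strict_mono_on {0<..<1} (\<lambda>y. \<phi> (g y))"
    and "\<And>y. y \<in> {0<..<1} - \<rat> \<Longrightarrow> limitin mtopology g (g y) (at y)"
proof -
  define good where "good U \<longleftrightarrow> openin mtopology U \<and> uncountable (\<phi> ` U)" for U
  \<comment> \<open>Nodes are open sets with uncountable image. Keeping the closure of a child
    inside its parent places limit points in the open nodes, and the radius bound makes the nodes of
    a branch shrink.\<close>
  define shrink where "shrink U n V \<longleftrightarrow> good V \<and> mtopology closure_of V \<subseteq> U \<and>
    (\<exists>a. V \<subseteq> mcball a (1 / Suc n))" for U n V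
  have "\<exists>A B. shrink U n A \<and> shrink U n B \<and> (\<forall>x\<in>A. \<forall>y\<in>B. \<phi> x < \<phi> y)" if "good U" for U n
  proof -
    have U: "openin mtopology U" "uncountable (\<phi> ` U)" using that by (simp_all add: good_def)
    have "0 < 1 / real (Suc n)" by simp
    then obtain a b r s where ab: "r \<le> 1 / Suc n" "s \<le> 1 / Suc n" "mcball a r \<subseteq> U" "mcball b s \<subseteq> U"
      "uncountable (\<phi> ` mball a r)" "uncountable (\<phi> ` mball b s)"
      and less: "\<And>x y. x \<in> mcball a r \<Longrightarrow> y \<in> mcball b s \<Longrightarrow> \<phi> x < \<phi> y"
      by (rule uncountable_image_split[OF sep cont U]) blast
    have sh: "shrink U n (mball c t)"
      if "t \<le> 1 / Suc n" "mcball c t \<subseteq> U" "uncountable (\<phi> ` mball c t)" for c t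
    proof -
      have "mtopology closure_of mball c t \<subseteq> mcball c t"
        by (rule closure_of_minimal) (simp_all add: mball_subset_mcball)
      moreover have "mball c t \<subseteq> mcball c (1 / Suc n)" using that(1) by auto
      ultimately show ?thesis using that openin_mball unfolding shrink_def good_def by (meson subset_trans)
    qed
    have "\<forall>x\<in>mball a r. \<forall>y\<in>mball b s. \<phi> x < \<phi> y"
      using less mball_subset_mcball by (meson subsetD)
    then show ?thesis using sh[OF ab(1,3,5)] sh[OF ab(2,4,6)] by (intro exI conjI)
  qed
  then obtain L R where LR: "\<And>U n. good U \<Longrightarrow> shrink U n (L U n) \<and> shrink U n (R U n) \<and>
      (\<forall>x\<in>L U n. \<forall>y\<in>R U n. \<phi> x < \<phi> y)"
    by metis
  \<comment> \<open>\<open>V y n\<close> is the node of depth \<open>n\<close> on the branch of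
    \<open>y\<close>: the parity is the binary digit number \<open>n + 1\<close>, and digit 0 goes
    left.\<close>
  define V where "V = (\<lambda>y::real. rec_nat M
    (\<lambda>n U. if even \<lfloor>2 ^ Suc n * y\<rfloor> then L U n else R U n))"
  have V_0: "V y 0 = M" and V_Suc: "V y (Suc n) =
      (if even \<lfloor>2 ^ Suc n * y\<rfloor> then L (V y n) n else R (V y n) n)" for y n
    by (simp_all add: V_def)
  have good_V: "good (V y n)" for y n
  proof (induction n)
    case 0
    then show ?case using unc openin_topspace[of mtopology] by (simp add: good_def V_0)
  next
    case (Suc n)
    then show ?case using LR[OF Suc] by (simp add: V_Suc shrink_def)
  qed
  have shrink_V: "shrink (V y n) n (V y (Suc n))" for y n
    using LR[OF good_V] by (simp add: V_Suc)
  have V_M: "V y n \<subseteq> M" for y n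
    using good_V[of y n] openin_subset unfolding good_def by fastforce
  then have V_closure: "V y n \<subseteq> mtopology closure_of V y n" for y n
    by (simp add: closure_of_subset)
  \<comment> \<open>Completeness, in the form of nested closed sets contained in arbitrarily small
    balls.\<close>
  have "(\<Inter>n. mtopology closure_of V y n) \<noteq> {}" for y
  proof -
    have "decseq (\<lambda>n. mtopology closure_of V y n)"
      using shrink_V V_closure unfolding shrink_def by (intro decseq_SucI) blast
    moreover have "mtopology closure_of V y n \<noteq> {}" for n
      using good_V[of y n] V_closure[of y n] unfolding good_def by force
    moreover have "\<exists>n a. mtopology closure_of V y n \<subseteq> mcball a \<epsilon>" if "\<epsilon> > 0" for \<epsilon>
    proof -
      obtain n where n: "1 / real (Suc n) < \<epsilon>" using nat_approx_posE[OF \<open>\<epsilon> > 0\<close>] by blast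
      obtain a where "V y (Suc n) \<subseteq> mcball a (1 / Suc n)"
        using shrink_V[of y n] unfolding shrink_def by blast
      then have "V y (Suc n) \<subseteq> mcball a \<epsilon>"
        using mcball_subset_concentric[of "1 / Suc n" \<epsilon> a] n by (meson less_imp_le subset_trans)
      then show ?thesis by (meson closedin_mcball closure_of_minimal)
    qed
    ultimately show ?thesis using compl[unfolded mcomplete_nest] by fastforce
  qed
  then have "\<exists>x. x \<in> (\<Inter>n. mtopology closure_of V y n)" for y by (simp only: ex_in_conv not_False_eq_True)
  then obtain g where g_closure: "\<And>y. g y \<in> (\<Inter>n. mtopology closure_of V y n)" by metis
  have g: "g y \<in> V y n" for y n
  proof -
    have "g y \<in> mtopology closure_of V y (Suc n)" using g_closure[of y] by (rule INT_D) simp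
    moreover have "mtopology closure_of V y (Suc n) \<subseteq> V y n"
      using shrink_V[of y n] by (simp only: shrink_def)
    ultimately show ?thesis by (rule subsetD[rotated])
  qed
  \<comment> \<open>A node depends only on the digits read so far, and the last floor determines the
    earlier ones by halving.\<close>
  have V_cong: "V y n = V y' n" if "y \<in> {0<..<1}" "y' \<in> {0<..<1}" "\<lfloor>2 ^ n * y\<rfloor> = \<lfloor>2 ^ n * y'\<rfloor>" for y y' n
    using that(3)
  proof (induction n)
    case 0
    then show ?case by (simp add: V_0)
  next
    case (Suc n)
    then have "\<lfloor>2 ^ n * y\<rfloor> = \<lfloor>2 ^ n * y'\<rfloor>" by (metis floor_dyadic_div_2)
    then show ?case using Suc by (simp only: V_Suc)
  qed
  show thesis
  proof (rule that)
    show "g y \<in> M" for y using g[of y 0] by (simp add: V_0)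
    show "strict_mono_on {0<..<1} (\<lambda>y. \<phi> (g y))"
    proof (rule strict_mono_onI)
      fix y y' :: real assume y: "y \<in> {0<..<1}" "y' \<in> {0<..<1}" "y < y'"
      \<comment> \<open>The first digit where \<open>y\<close> and \<open>y'\<close> differ. It is
        not number 0, as both integer parts vanish; since \<open>y < y'\<close>, the digit is 0 for
        \<open>y\<close> and 1 for \<open>y'\<close>, so the branches split left and right at a
        common node.\<close>
      define n where "n = (LEAST n. \<lfloor>2 ^ n * y\<rfloor> \<noteq> \<lfloor>2 ^ n * y'\<rfloor>)"
      have n: "\<lfloor>2 ^ n * y\<rfloor> \<noteq> \<lfloor>2 ^ n * y'\<rfloor>"
        unfolding n_def by (rule LeastI_ex) (rule dyadic_separation[OF y(3)])
      have "\<lfloor>y\<rfloor> = 0" "\<lfloor>y'\<rfloor> = 0" using y by (simp_all add: floor_eq_iff)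
      then have "n \<noteq> 0" using n by (metis power_0 mult_1)
      then obtain m where m: "n = Suc m" using not0_implies_Suc by blast
      then have eq: "\<lfloor>2 ^ m * y\<rfloor> = \<lfloor>2 ^ m * y'\<rfloor>"
        using not_less_Least[of m "\<lambda>n. \<lfloor>2 ^ n * y\<rfloor> \<noteq> \<lfloor>2 ^ n * y'\<rfloor>"] by (simp add: n_def)
      have "2 ^ n * y \<le> 2 ^ n * y'" using y(3) by simp
      then have "\<lfloor>2 ^ n * y\<rfloor> \<le> \<lfloor>2 ^ n * y'\<rfloor>" by (rule floor_mono)
      moreover have "\<lfloor>2 ^ n * y\<rfloor> div 2 = \<lfloor>2 ^ n * y'\<rfloor> div 2"
        unfolding m floor_dyadic_div_2 by (rule eq)
      moreover have "even p \<and> odd q" if "p \<le> q" "p div 2 = q div 2" "p \<noteq> q" for p q :: int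
        using that by presburger
      ultimately have "even \<lfloor>2 ^ n * y\<rfloor>" "odd \<lfloor>2 ^ n * y'\<rfloor>" using n by simp_all
      then have "g y \<in> L (V y m) m" "g y' \<in> R (V y m) m"
        using g[of y n] g[of y' n] V_cong[OF y(1,2) eq] unfolding m V_Suc by simp_all
      then show "\<phi> (g y) < \<phi> (g y')" using LR[OF good_V[of y m], of m] by simp
    qed
    show "limitin mtopology g (g y) (at y)" if y: "y \<in> {0<..<1} - \<rat>" for y
      unfolding limitin_metric
    proof (intro conjI allI impI)
      show "g y \<in> M" using g[of y 0] by (simp add: V_0)
      fix \<epsilon> :: real assume "\<epsilon> > 0"
      then obtain n where n: "1 / real (Suc n) < \<epsilon> / 2" using nat_approx_posE[of "\<epsilon> / 2"] by auto
      obtain a where a: "V y (Suc n) \<subseteq> mcball a (1 / Suc n)"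
        using shrink_V[of y n] unfolding shrink_def by blast
      \<comment> \<open>Hence points near \<open>y\<close> share its node of depth
        \<open>n + 1\<close>, which lies in a ball of radius below
        \<open>\<epsilon> / 2\<close>.\<close>
      have "2 ^ Suc n * y \<notin> \<int>"
      proof
        assume "2 ^ Suc n * y \<in> \<int>"
        then have "2 ^ Suc n * y / 2 ^ Suc n \<in> \<rat>" by (meson Ints_subset_Rats Rats_divide Rats_number_of Rats_power subsetD)
        then show False using y by simp
      qed
      then have "\<forall>\<^sub>F x in at y. \<lfloor>2 ^ Suc n * x\<rfloor> = \<lfloor>2 ^ Suc n * y\<rfloor>" by (rule eventually_floor_mult_eq)
      moreover have "\<forall>\<^sub>F x in at y. x \<in> {0<..<1}"
        using y by (intro eventually_at_in_open') auto
      ultimately show "\<forall>\<^sub>F x in at y. g x \<in> M \<and> d (g x) (g y) < \<epsilon>"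
      proof eventually_elim
        case (elim x)
        then have "V x (Suc n) = V y (Suc n)" using y by (intro V_cong) auto
        then have "g x \<in> mcball a (1 / Suc n)" "g y \<in> mcball a (1 / Suc n)"
          using a g[of x "Suc n"] g[of y "Suc n"] by (simp_all only: subset_iff)
        then have "g x \<in> M" "d (g x) (g y) \<le> 1 / Suc n + 1 / Suc n"
          using triangle[of "g x" a "g y"] commute[of a "g x"] by auto
        then show ?case using n by linarith
      qed
    qed
  qed
qed

section \<open>Curves over Cantor sets\<close>

text \<open>Tychonoff for a product of two-point spaces.\<close>

lemma Cantor_set_imp_compact:
  assumes "Cantor_set C"
  shows "compact C"
proof -
  have "compactin (product_topology (\<lambda>i::nat. euclidean) UNIV) (PiE UNIV (\<lambda>i. UNIV :: bool set))"
    by (subst compactin_PiE) (simp add: finite_imp_compact)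
  then have "compact (UNIV :: (nat \<Rightarrow> bool) set)"
    by (simp add: euclidean_product_topology)
  then show ?thesis
    using assms homeomorphic_compactness unfolding Cantor_set_def by blast
qed

text \<open>Each coordinate of the homeomorphism is a continuous map to a discrete space, hence
  constant on \<open>S\<close>.\<close>

lemma connected_subset_Cantor_set:
  assumes C: "Cantor_set C" and S: "connected S" "S \<subseteq> C" and xy: "x \<in> S" "y \<in> S"
  shows "x = y"
proof -
  obtain f g where fg: "homeomorphism C (UNIV :: (nat \<Rightarrow> bool) set) f g"
    using C unfolding Cantor_set_def homeomorphic_def by blast
  have cont: "continuous_on S f"
    using fg S(2) continuous_on_subset homeomorphism_def by metis
  have "f x n = f y n" for n
  proof -
    have "continuous_on S (\<lambda>z. f z n)"
      by (rule continuous_on_compose2[OF _ cont]) auto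
    then have "connected ((\<lambda>z. f z n) ` S)" using S(1) by (rule connected_continuous_image)
    then have "{f x n} \<inter> (\<lambda>z. f z n) ` S = {} \<or> {\<not> f x n} \<inter> (\<lambda>z. f z n) ` S = {}"
      by (rule connectedD) (auto simp: open_discrete)
    then show ?thesis using xy by blast
  qed
  then have "f x = f y" by blast
  then show ?thesis using fg S(2) xy unfolding homeomorphism_def by (metis subsetD)
qed

text \<open>Baire category: the sets \<open>q - E\<close> for rational \<open>q\<close> are closed
  with empty interior, so some \<open>t\<close> in the unit interval avoids all of them.\<close>

lemma irrational_translate:
  fixes E :: "real set"
  assumes E: "closed E" "interior E = {}"
  obtains t where "t \<in> {0<..<1}" "\<And>e. e \<in> E \<Longrightarrow> e + t \<notin> \<rat>"
proof -
  define A where "A q = (\<lambda>t. q - t) -` E" for q :: real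
  have A: "closed (A q)" "interior (A q) = {}" for q
  proof -
    show "closed (A q)" unfolding A_def using E(1) by (intro closed_vimage continuous_intros)
    have "open ((\<lambda>t. q - t) -` interior (A q))"
      by (intro open_vimage continuous_intros) simp
    moreover have "(\<lambda>t. q - t) -` interior (A q) \<subseteq> E"
      using interior_subset[of "A q"] by (auto simp: A_def)
    ultimately have "(\<lambda>t. q - t) -` interior (A q) \<subseteq> {}" using E(2) interior_maximal by blast
    then have "q - (q - t) \<notin> interior (A q)" for t by blast
    then show "interior (A q) = {}" by auto
  qed
  have "(UNIV :: real set) \<subseteq> closure (\<Inter>((\<lambda>q. - A q) ` \<rat>))"
    by (rule Baire) (use A in \<open>auto simp: countable_rat closure_complement\<close>)
  then have "{0<..<1} \<inter> closure (\<Inter>((\<lambda>q. - A q) ` \<rat>)) \<noteq> {}" by (simp add: top.extremum_unique)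
  then have "{0<..<1} \<inter> \<Inter>((\<lambda>q. - A q) ` \<rat>) \<noteq> {}"
    by (subst (asm) open_Int_closure_eq_empty) auto
  then obtain t where t: "t \<in> {0<..<1}" "\<And>q. q \<in> \<rat> \<Longrightarrow> t \<notin> A q" by blast
  have "e + t \<notin> \<rat>" if "e \<in> E" for e
    using t(2)[of "e + t"] that by (auto simp: A_def)
  then show thesis using that t(1) by blast
qed

text \<open>Otherwise \<open>B\<close> would embed in a finite product of countable sets.\<close>

lemma uncountable_coordinate_image:
  fixes B :: "(real ^ 'n) set"
  assumes "uncountable B"
  obtains i where "uncountable ((\<lambda>x. x $ i) ` B)"
proof (rule ccontr)
  assume "\<not> thesis"
  then have "countable ((\<lambda>x. x $ i) ` B)" for i using that by blast
  then have "countable (PiE UNIV (\<lambda>i. (\<lambda>x. x $ i) ` B))" by (intro countable_PiE) auto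
  moreover have "vec_nth ` B \<subseteq> PiE UNIV (\<lambda>i. (\<lambda>x. x $ i) ` B)" by auto
  ultimately have "countable (vec_nth ` B)" by (rule countable_subset[rotated])
  moreover have "inj_on vec_nth B" by (simp add: inj_on_def vec_nth_inject)
  ultimately show False using assms countable_image_inj_on by blast
qed

text \<open>The transversal is built for the \<open>i\<close>-th coordinate of the parametrisation
  and composed with an affine map of \<open>E\<close> into its continuity points.\<close>

lemma analytic_set_contains_curve:
  fixes B :: "(real ^ 'n) set" and E :: "real set"
  assumes B: "analytic_set B" "uncountable ((\<lambda>x. x $ i) ` B)"
    and E: "compact E" "interior E = {}"
  obtains \<gamma> where "continuous_on E \<gamma>" "strict_mono_on E (\<lambda>t. \<gamma> t $ i)" "\<gamma> ` E \<subseteq> B"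
proof -
  obtain T :: "(nat \<Rightarrow> real) topology" and f where T: "Polish_space T"
    and f: "continuous_map T euclidean f" and Bf: "B = f ` topspace T"
    using B(1) unfolding analytic_set_def by blast
  obtain M d where "Metric_space M d" and compl: "Metric_space.mcomplete M d"
    and T_eq: "T = Metric_space.mtopology M d"
    using T unfolding Polish_space_def completely_metrizable_space_def by blast
  interpret Metric_space M d by fact
  have top: "topspace T = M" by (simp add: T_eq)
  have "continuous_map T euclideanreal (\<lambda>p. f p $ i)"
    using continuous_map_compose[OF f, of euclideanreal "\<lambda>x. x $ i"]
    by (simp add: o_def continuous_on_component)
  moreover have "uncountable ((\<lambda>p. f p $ i) ` M)"
    using B(2) by (simp add: Bf top image_image)
  ultimately obtain g where g: "\<And>y. y \<in> {0<..<1::real} \<Longrightarrow> g y \<in> M"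
    and mono: "strict_mono_on {0<..<1} (\<lambda>y. f (g y) $ i)"
    and lim: "\<And>y. y \<in> {0<..<1} - \<rat> \<Longrightarrow> limitin mtopology g (g y) (at y)"
    using T unfolding Polish_space_def T_eq by (rule_tac increasing_transversal[OF compl]) blast+
  obtain t where t: "t \<in> {0<..<1}" "\<And>e. e \<in> E \<Longrightarrow> e + t \<notin> \<rat>"
    using irrational_translate[OF compact_imp_closed[OF E(1)] E(2)] by blast
  obtain m where m: "\<And>e. e \<in> E \<Longrightarrow> \<bar>e\<bar> \<le> m" using compact_imp_bounded[OF E(1)]
    by (auto simp: bounded_iff)
  obtain N :: nat where N: "m < real N" using reals_Archimedean2 by blast
  \<comment> \<open>The shift by \<open>t\<close> makes points of \<open>E\<close> irrational; the
    rest has rational coefficients and, by \<open>\<bar>e\<bar> \<le> m < N\<close> and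
    \<open>0 < t < 1\<close>, lands in the unit interval.\<close>
  define a where "a e = (e + t + real N) / (2 * real N + 1)" for e
  have a01: "a e \<in> {0<..<1} - \<rat>" if e: "e \<in> E" for e
  proof -
    have "e + t \<in> \<rat>" if "a e \<in> \<rat>"
    proof -
      have "a e * (2 * real N + 1) - real N \<in> \<rat>" using that by (intro Rats_diff Rats_mult Rats_add) auto
      then show ?thesis by (simp add: a_def)
    qed
    moreover have "0 < e + t + real N" "e + t + real N < 2 * real N + 1"
      using m[OF e] N t(1) by auto
    ultimately show ?thesis using t(2)[OF e] by (auto simp: a_def)
  qed
  have a_less: "a e < a e'" if "e < e'" for e e'
    using that by (simp add: a_def divide_strict_right_mono)
  show thesis
  proof
    show "continuous_on E (\<lambda>e. f (g (a e)))"
    proof (rule continuous_at_imp_continuous_on, intro ballI)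
      fix e assume e: "e \<in> E"
      have "limitin euclidean (f \<circ> g) (f (g (a e))) (at (a e))"
        using f lim[OF a01[OF e]] unfolding T_eq by (rule continuous_map_limit)
      then have "isCont (\<lambda>y. f (g y)) (a e)" by (simp add: isCont_def o_def)
      moreover have "isCont a e" unfolding a_def by (intro continuous_intros) auto
      ultimately show "isCont (\<lambda>e. f (g (a e))) e" by (rule isCont_o2[rotated])
    qed
    show "strict_mono_on E (\<lambda>e. f (g (a e)) $ i)"
      using mono a01 a_less by (simp add: strict_mono_on_def)
    show "(\<lambda>e. f (g (a e))) ` E \<subseteq> B"
      using g a01 by (auto simp: Bf top)
  qed
qed

section \<open>Moving tame Cantor sets into the ideal\<close>

lemma topologically_invariant_image:
  assumes "topologically_invariant X \<I>" "homeomorphism X X h g" "A \<in> \<I>"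
  shows "h ` A \<in> \<I>"
  using assms unfolding topologically_invariant_def by blast

text \<open>One ambient homeomorphism flattens \<open>C\<close> into the axis, a second carries the
  flat copy into \<open>B\<close>. The image is in the ideal as a subset of \<open>B\<close>, and
  invariance brings it back to \<open>C\<close>.\<close>

lemma tame_Cantor_set_in_ideal:
  fixes k :: "'n::finite" and \<I> :: "(real ^ 'n) set set"
  assumes ideal: "set_ideal UNIV \<I>" and inv: "topologically_invariant UNIV \<I>"
    and B: "B \<in> \<I>" "analytic_set B" "uncountable B" and C: "tame_Cantor_set k C"
  shows "C \<in> \<I>"
proof -
  obtain h g where hg: "homeomorphism UNIV UNIV h g" and L: "Cantor_set (h ` C)"
    "h ` C \<subseteq> coordinate_line k"
    using C unfolding tame_Cantor_set_def by blast
  define E where "E = (\<lambda>x. x $ k) ` h ` C"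
  have axis: "axis k (x $ k) = x" if "x \<in> h ` C" for x
    using that L(2) unfolding coordinate_line_def by (auto simp: vec_eq_iff axis_def)
  then have L_eq: "h ` C = axis k ` E" by (force simp: E_def)
  have "compact E"
    unfolding E_def
    by (rule compact_continuous_image[OF _ Cantor_set_imp_compact[OF L(1)]]) (intro continuous_intros)
  have "interior E = {}"
  proof (rule ccontr)
    assume "interior E \<noteq> {}"
    then obtain x e where "e > 0" and e: "cball x e \<subseteq> E" by (auto simp: mem_interior_cball)
    have "connected (axis k ` cball x e :: (real ^ 'n) set)"
      by (intro connected_continuous_image linear_continuous_on linear_conv_bounded_linear[THEN iffD1])
        (auto simp: linear_iff vec_eq_iff axis_def)
    moreover have "axis k ` cball x e \<subseteq> h ` C" using e L_eq by blast
    moreover have "axis k x \<in> axis k ` cball x e" "axis k (x + e) \<in> axis k ` cball x e"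
      using \<open>e > 0\<close> by (auto simp: dist_real_def)
    ultimately have "axis k x = (axis k (x + e) :: real ^ 'n)"
      using connected_subset_Cantor_set[OF L(1)] by blast
    then show False using \<open>e > 0\<close> by (simp add: axis_eq_axis)
  qed
  obtain i where i: "uncountable ((\<lambda>x. x $ i) ` B)"
    using uncountable_coordinate_image[OF B(3)] by blast
  obtain \<gamma> where \<gamma>: "continuous_on E \<gamma>" "strict_mono_on E (\<lambda>t. \<gamma> t $ i)" "\<gamma> ` E \<subseteq> B"
    using analytic_set_contains_curve[OF B(2) i \<open>compact E\<close> \<open>interior E = {}\<close>] by blast
  obtain H G where HG: "homeomorphism UNIV UNIV H G" "\<And>t. t \<in> E \<Longrightarrow> H (axis k t) = \<gamma> t"
    by (rule homeomorphism_axis_to_curve[OF \<open>compact E\<close> \<gamma>(1,2), of k]) blast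
  have "H ` h ` C \<subseteq> B" using \<gamma>(3) HG(2) by (auto simp: L_eq)
  then have "H ` h ` C \<in> \<I>" using ideal B(1) unfolding set_ideal_def by blast
  then have "g ` G ` H ` h ` C \<in> \<I>"
    using inv HG(1) hg by (meson homeomorphism_sym topologically_invariant_image)
  moreover have "g ` G ` H ` h ` C = C"
    using hg HG(1) by (simp add: image_image homeomorphism_def)
  ultimately show ?thesis by simp
qed

theorem theorem2p2:
  fixes k :: "'n::finite" and \<I> :: "(real ^ 'n) set set"
  assumes "sigma_ideal UNIV \<I>"
    and "nontrivial_ideal UNIV \<I>"
    and "topologically_invariant UNIV \<I>"
    and "has_analytic_base \<I>"
  shows "sigma_C0 k \<subseteq> \<I>"
proof
  fix S assume "S \<in> sigma_C0 k"
  then obtain \<C> where \<C>: "countable \<C>" "\<And>C. C \<in> \<C> \<Longrightarrow> tame_Cantor_set k C" "S \<subseteq> \<Union>\<C>"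
    unfolding sigma_C0_def by blast
  have ideal: "set_ideal UNIV \<I>" using assms(1) by (simp add: sigma_ideal_def)
  obtain A where "A \<in> \<I>" "uncountable A"
    using assms(2) unfolding nontrivial_ideal_def by blast
  then obtain B where "B \<in> \<I>" "analytic_set B" "uncountable B"
    using assms(4) countable_subset unfolding has_analytic_base_def by metis
  then have "\<C> \<subseteq> \<I>"
    using tame_Cantor_set_in_ideal[OF ideal assms(3)] \<C>(2) by blast
  then have "\<Union>\<C> \<in> \<I>" using assms(1) \<C>(1) unfolding sigma_ideal_def by blast
  then show "S \<in> \<I>" using ideal \<C>(3) unfolding set_ideal_def by blast
qed

end
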